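(* In $\mathbb{F}_3^3$, a maximal $2$-cap has size $5$, i.e. $r(2,\mathbb{F}_3^3)=5$. Moreover, every complete $2$-cap in $\mathbb{F}_3^3$ is maximal, and any two maximal $2$-caps in $\mathbb{F}_3^3$ are affinely equivalent.
   Context: $\mathbb{F}_3^n$ denotes $n$-dimensional affine space over the field with three elements. A subset $C \subseteq \mathbb{F}_3^n$ is a $2$-cap if no three points of $C$ lie on a $1$-dimensional affine subspace and no four points of $C$ lie on a $2$-dimensional affine subspace (equivalently, every subset of $C$ of size at most $4$ is affinely independent). A $2$-cap is complete if it is not a proper subset of another $2$-cap, and maximal if it has the largest possible cardinality; $r(2,\mathbb{F}_3^n)$ denotes this largest cardinality. Two subsets $C,D$ are affinely equivalent if there is an invertible affine transformation $T$ of $\mathbb{F}_3^n$ with $T(C)=D$. *)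

theory Defs
  imports "HOL-Analysis.Cartesian_Space"
begin

(* Affine space over a field 'k is modelled by 'k ^ 'n; an affine subspace is a
   translate of a linear one, and its dimension is that of the direction space. *)
definition affine_subspace :: "nat \<Rightarrow> ('k::field ^ 'n) set \<Rightarrow> bool" where
  "affine_subspace d A \<longleftrightarrow>
     (\<exists>a S. vec.subspace S \<and> vec.dim S = d \<and> A = (\<lambda>x. a + x) ` S)"

definition two_cap :: "('k::field ^ 'n) set \<Rightarrow> bool" where
  "two_cap C \<longleftrightarrow>
     \<not> (\<exists>T L. T \<subseteq> C \<and> card T = 3 \<and> affine_subspace 1 L \<and> T \<subseteq> L) \<and>
     \<not> (\<exists>T P. T \<subseteq> C \<and> card T = 4 \<and> affine_subspace 2 P \<and> T \<subseteq> P)"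

definition complete_two_cap :: "('k::field ^ 'n) set \<Rightarrow> bool" where
  "complete_two_cap C \<longleftrightarrow> two_cap C \<and> \<not> (\<exists>D. two_cap D \<and> C \<subset> D)"

(* Finiteness of 'k makes every card below a genuine cardinality and Max a maximum
   over a finite set, which is nonempty because the empty set is a 2-cap. *)
definition maximal_two_cap :: "('k::{field,finite} ^ 'n) set \<Rightarrow> bool" where
  "maximal_two_cap C \<longleftrightarrow> two_cap C \<and> (\<forall>D :: ('k ^ 'n) set. two_cap D \<longrightarrow> card D \<le> card C)"

definition r_two :: "('k::{field,finite} ^ 'n) itself \<Rightarrow> nat" where
  "r_two _ = Max (card ` {C :: ('k ^ 'n) set. two_cap C})"

definition affinely_equivalent :: "('k::field ^ 'n) set \<Rightarrow> ('k ^ 'n) set \<Rightarrow> bool" where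
  "affinely_equivalent C D \<longleftrightarrow>
     (\<exists>(M :: 'k ^ 'n ^ 'n) b. invertible M \<and> (\<lambda>x. M *v x + b) ` C = D)"

end

theory Submission
  imports Defs
begin

text \<open>
  Over the field with three elements, three distinct points are collinear iff they sum to 0,
  and four distinct points with no three collinear are coplanar iff two of them have the same sum
  as the other two. In dimension 3, four points of a 2-cap form an affine frame, and a fifth point
  of the cap has only nonzero barycentric coordinates with respect to it; these are (1,1,1,1) or
  a permutation of (1,-1,-1,-1), so in either case one of the five points is the sum of the other
  four. With the frame chosen such that the fifth point is that sum, a sixth point would be
  collinear with it and a frame point. Hence the caps of size 5 are exactly the frames together
  with the sum of their points, and affine maps act transitively on frames.
  A cap C of size at most 3 is not complete, because the points x + y - z with x, y, z in C, which
  are all that cannot be added to it, number fewer than 27.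
\<close>

section \<open>Arithmetic in the field with three elements\<close>

text \<open>If 1 = -1, then for any \<open>t\<close> outside {0, 1} the elements 0, 1,
  \<open>t\<close>, \<open>t + 1\<close> would be four distinct ones. So 0, 1, -1 exhaust the field,
  and 2, being neither 0 nor 1, must be -1.\<close>

lemma field_card_3:
  assumes "CARD('k::{field,finite}) = 3"
  shows "(3::'k) = 0" and "(1::'k) \<noteq> -1" and "x = 0 \<or> x = 1 \<or> x = (-1::'k)"
proof -
  show ne: "(1::'k) \<noteq> -1"
  proof
    assume h: "(1::'k) = -1"
    have "card {0, 1 :: 'k} = 2" by simp
    hence "{0, 1 :: 'k} \<noteq> UNIV" using assms by (intro notI) simp
    then obtain t :: 'k where t: "t \<notin> {0, 1}" by blast
    have "t + 1 \<noteq> 0"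
    proof
      assume "t + 1 = 0"
      hence "t = -1" by (simp only: eq_neg_iff_add_eq_0)
      with t h show False by simp
    qed
    hence "card {0, 1, t, t + 1} = 4" using t by (auto simp: card_insert_if)
    moreover have "card {0, 1, t, t + 1} \<le> CARD('k)" by (rule card_mono) auto
    ultimately show False using assms by simp
  qed
  have "card {0, 1, -1::'k} = 3" using ne by (auto simp: card_insert_if)
  hence U: "{0, 1, -1::'k} = UNIV" using assms by (intro card_subset_eq) auto
  thus "x = 0 \<or> x = 1 \<or> x = (-1::'k)" by blast
  have "(2::'k) \<in> {0, 1, -1}" using U by blast
  moreover have "(2::'k) \<noteq> 0" using ne eq_neg_iff_add_eq_0[of "1::'k" 1] by simp
  moreover have "(2::'k) \<noteq> 1" using add_left_cancel[of 1 1 "0::'k"] by simp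
  ultimately have "(2::'k) = -1" by simp
  hence "(2::'k) + 1 = 0" by (simp only: eq_neg_iff_add_eq_0)
  thus "(3::'k) = 0" by simp
qed

text \<open>Turns every coefficient in a linear combination into a three-way case split, so that
  membership in a span becomes a finite list of equations.\<close>

lemma smult_cases:
  assumes "CARD('k::{field,finite}) = 3"
  shows "c *s v = 0 \<or> c *s v = v \<or> c *s v = - (v :: 'k ^ 'n)"
  using field_card_3(3)[OF assms, of c] by (auto simp: vec_eq_iff)

lemma triple_eq_0:
  assumes "CARD('k::{field,finite}) = 3"
  shows "v + v + v = (0 :: 'k ^ 'n)"
proof -
  have "x + x + x = 3 * x" for x :: 'k by simp
  thus ?thesis using field_card_3(1)[OF assms] by (simp add: vec_eq_iff)
qed

section \<open>Collinearity and coplanarity as conditions on sums\<close>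

text \<open>If \<open>z - x\<close> were \<open>c *s (y - x)\<close>, then \<open>c\<close> = 0
  gives \<open>z = x\<close>, \<open>c\<close> = 1 gives \<open>z = y\<close>, and \<open>c\<close>
  = -1 gives \<open>x + y + z = x + x + x\<close>, which is 0.\<close>

lemma independent_differences:
  fixes x y z :: "'k::{field,finite} ^ 'n"
  assumes k: "CARD('k) = 3" and "x \<noteq> y" "x \<noteq> z" "y \<noteq> z" "x + y + z \<noteq> 0"
  shows "vec.independent {y - x, z - x}"
proof -
  have "z - x \<notin> vec.span {y - x}"
  proof
    assume "z - x \<in> vec.span {y - x}"
    then obtain c where c: "z - x = c *s (y - x)" by (auto simp: vec.span_singleton)
    have "z - x = -(y - x) \<Longrightarrow> x + y + z = x + x + x" by (simp add: algebra_simps)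
    with c show False
      using smult_cases[OF k, of c "y - x"] assms triple_eq_0[OF k] by fastforce
  qed
  hence "vec.independent {z - x, y - x}"
    using assms by (intro vec.independent_insertI) (auto simp: vec.independent_empty)
  thus ?thesis by (simp add: insert_commute)
qed

text \<open>Nine pairs of coefficients are possible for \<open>w - x\<close>. Three make
  \<open>w\<close> equal to \<open>x\<close>, \<open>y\<close> or \<open>z\<close>, three put it on
  a line with two of these points, and three make it complete them to a parallelogram.\<close>

lemma difference_notin_span:
  fixes w x y z :: "'k::{field,finite} ^ 'n"
  assumes k: "CARD('k) = 3" and d: "distinct [x, y, z, w]"
    and "x + y + w \<noteq> 0" "x + z + w \<noteq> 0" "y + z + w \<noteq> 0"
    and "x + y \<noteq> z + w" "x + z \<noteq> y + w" "x + w \<noteq> y + z"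
  shows "w - x \<notin> vec.span {y - x, z - x}"
proof
  assume "w - x \<in> vec.span {y - x, z - x}"
  then obtain a b where "w - x - a *s (y - x) = b *s (z - x)"
    by (auto simp: vec.span_insert vec.span_singleton)
  then obtain A B where "w - x - A = B" "A = 0 \<or> A = y - x \<or> A = - (y - x)"
    "B = 0 \<or> B = z - x \<or> B = - (z - x)"
    using smult_cases[OF k, of a "y - x"] smult_cases[OF k, of b "z - x"] by blast
  \<comment> \<open>One disjunct per pair of coefficients. Writing \<open>x + x + x\<close> in place
    of 0 makes each case a consequence of the abelian group laws alone; characteristic 3 enters only
    afterwards.\<close>
  hence "w = x \<or> w = y \<or> w = z \<or> x + y + w = x + x + x \<or> x + z + w = x + x + x \<or>
    y + z + w = x + x + x \<or> x + y = z + w \<or> x + z = y + w \<or> x + w = y + z"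
    by (elim disjE; hypsubst; simp only: diff_eq_eq; simp add: algebra_simps)
  thus False unfolding triple_eq_0[OF k] using assms by auto
qed

text \<open>A zero sum or an equality of two sums expresses the last point through the others inside
  a line or plane. Conversely, without such relations the differences from one point are
  independent, two of them for a triple and three for a quadruple, which is one too many for the
  direction space.\<close>

lemma two_cap_iff:
  fixes C :: "('k::{field,finite} ^ 'n) set"
  assumes k: "CARD('k) = 3"
  shows "two_cap C \<longleftrightarrow>
    (\<forall>x\<in>C. \<forall>y\<in>C. \<forall>z\<in>C. distinct [x, y, z] \<longrightarrow> x + y + z \<noteq> 0) \<and>
    (\<forall>x\<in>C. \<forall>y\<in>C. \<forall>z\<in>C. \<forall>w\<in>C. distinct [x, y, z, w] \<longrightarrow> x + y \<noteq> z + w)"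
    (is "_ \<longleftrightarrow> ?L \<and> ?P")
proof (intro iffI conjI)
  assume cap: "two_cap C"
  have tr: "v + v + v = 0" for v :: "'k ^ 'n" by (rule triple_eq_0[OF k])
  show L: ?L
  proof (intro ballI impI notI)
    fix x y z assume C: "x \<in> C" "y \<in> C" "z \<in> C" and d: "distinct [x, y, z]" and s: "x + y + z = 0"
    have "x + y + z = x + x + x" using s tr by simp
    hence "z = x + (-1) *s (y - x)" by (simp add: algebra_simps)
    moreover have "y = x + 1 *s (y - x)" "x = x + 0 *s (y - x)" by simp_all
    ultimately have "{x, y, z} \<subseteq> (\<lambda>v. x + v) ` vec.span {y - x}"
      unfolding vec.span_singleton by blast
    moreover have "vec.dim (vec.span {y - x}) = 1"
      using d by (subst vec.dim_span_eq_card_independent) auto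
    hence "affine_subspace 1 ((\<lambda>v. x + v) ` vec.span {y - x})"
      unfolding affine_subspace_def using vec.subspace_span by blast
    moreover have "card {x, y, z} = 3" using d by auto
    moreover have "{x, y, z} \<subseteq> C" using C by simp
    ultimately show False using cap unfolding two_cap_def by blast
  qed
  show ?P
  proof (intro ballI impI notI)
    fix x y z w assume C: "x \<in> C" "y \<in> C" "z \<in> C" "w \<in> C"
      and d: "distinct [x, y, z, w]" and s: "x + y = z + w"
    let ?S = "vec.span {y - x, z - x}"
    \<comment> \<open>The line condition just proved makes the span have dimension exactly 2, as
      \<open>affine_subspace 2\<close> demands.\<close>
    have ind: "vec.independent {y - x, z - x}"
      using L C d by (intro independent_differences[OF k]) auto
    have mem: "y - x \<in> ?S" "z - x \<in> ?S" by (simp_all add: vec.span_base)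
    have "w = x + ((y - x) - (z - x))" using s by (simp add: algebra_simps)
    moreover have "(y - x) - (z - x) \<in> ?S" using mem by (rule vec.span_diff)
    moreover have "y = x + (y - x)" "z = x + (z - x)" "x = x + 0" by simp_all
    ultimately have "{x, y, z, w} \<subseteq> (\<lambda>v. x + v) ` ?S"
      using mem vec.span_zero by blast
    moreover have "vec.dim ?S = 2"
      using d ind by (subst vec.dim_span_eq_card_independent) auto
    hence "affine_subspace 2 ((\<lambda>v. x + v) ` ?S)"
      unfolding affine_subspace_def using vec.subspace_span by blast
    moreover have "card {x, y, z, w} = 4" using d by auto
    moreover have "{x, y, z, w} \<subseteq> C" using C by simp
    ultimately show False using cap unfolding two_cap_def by blast
  qed
next
  assume "?L \<and> ?P"
  hence L: "\<And>x y z. x \<in> C \<Longrightarrow> y \<in> C \<Longrightarrow> z \<in> C \<Longrightarrow> distinct [x, y, z] \<Longrightarrow> x + y + z \<noteq> 0"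
    and P: "\<And>x y z w. x \<in> C \<Longrightarrow> y \<in> C \<Longrightarrow> z \<in> C \<Longrightarrow> w \<in> C \<Longrightarrow>
      distinct [x, y, z, w] \<Longrightarrow> x + y \<noteq> z + w" by blast+
  \<comment> \<open>The base point \<open>a\<close> of the coset need not be one of the given
    points; it cancels in differences.\<close>
  have diff: "u - v \<in> S" if "vec.subspace S" "u \<in> (\<lambda>t. a + t) ` S" "v \<in> (\<lambda>t. a + t) ` S"
    for u v a :: "'k ^ 'n" and S
    using that by (auto intro: vec.subspace_diff)
  show "two_cap C"
    unfolding two_cap_def
  proof (intro conjI notI; elim exE conjE)
    fix T A assume T: "T \<subseteq> C" "card T = 3" "T \<subseteq> A" and A: "affine_subspace 1 A"
    obtain x y z where xyz: "T = {x, y, z}" "distinct [x, y, z]"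
      using T(2) by (auto simp: card_3_iff)
    obtain a S where S: "vec.subspace S" "vec.dim S = 1" "A = (\<lambda>t. a + t) ` S"
      using A by (auto simp: affine_subspace_def)
    have "vec.independent {y - x, z - x}"
      using L T xyz by (intro independent_differences[OF k]) auto
    moreover have "{y - x, z - x} \<subseteq> S" using diff[OF S(1)] S(3) T(3) xyz(1) by auto
    ultimately show False
      using vec.independent_card_le_dim[of "{y - x, z - x}" S] S(2) xyz(2) by auto
  next
    fix T A assume T: "T \<subseteq> C" "card T = 4" "T \<subseteq> A" and A: "affine_subspace 2 A"
    obtain x y z w where xyz: "T = {x, y, z, w}" "distinct [x, y, z, w]"
      using T(2) by (auto simp: card_Suc_eq numeral_eq_Suc)
    obtain a S where S: "vec.subspace S" "vec.dim S = 2" "A = (\<lambda>t. a + t) ` S"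
      using A by (auto simp: affine_subspace_def)
    have "vec.independent {y - x, z - x}"
      using L T xyz by (intro independent_differences[OF k]) auto
    moreover have "w - x \<notin> vec.span {y - x, z - x}"
      using L P T xyz by (intro difference_notin_span[OF k]) auto
    ultimately have "vec.independent {w - x, y - x, z - x}" by (rule vec.independent_insertI[rotated])
    moreover have "{w - x, y - x, z - x} \<subseteq> S" using diff[OF S(1)] S(3) T(3) xyz(1) by auto
    ultimately show False
      using vec.independent_card_le_dim[of "{w - x, y - x, z - x}" S] S(2) xyz(2) by auto
  qed
qed

lemma two_capD:
  fixes C :: "('k::{field,finite} ^ 'n) set"
  assumes "CARD('k) = 3" "two_cap C"
  shows "x \<in> C \<Longrightarrow> y \<in> C \<Longrightarrow> z \<in> C \<Longrightarrow> distinct [x, y, z] \<Longrightarrow> x + y + z \<noteq> 0"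
    and "x \<in> C \<Longrightarrow> y \<in> C \<Longrightarrow> z \<in> C \<Longrightarrow> w \<in> C \<Longrightarrow> distinct [x, y, z, w] \<Longrightarrow> x + y \<noteq> z + w"
  using two_cap_iff[THEN iffD1, OF assms] by simp_all

section \<open>Four points of a cap as an affine frame of the 3-space\<close>

lemma two_cap_notin_span:
  fixes C :: "('k::{field,finite} ^ 'n) set"
  assumes k: "CARD('k) = 3" and C: "two_cap C" "{x, y, z, w} \<subseteq> C" and d: "distinct [x, y, z, w]"
  shows "w - x \<notin> vec.span {y - x, z - x}"
  using C(2) d by (intro difference_notin_span[OF k d] two_capD[OF k C(1)]) auto

lemma two_cap_span_UNIV:
  fixes C :: "('k::{field,finite} ^ 3) set"
  assumes k: "CARD('k) = 3" and C: "two_cap C" "{x, y, z, w} \<subseteq> C" and d: "distinct [x, y, z, w]"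
  shows "vec.span {w - x, y - x, z - x} = UNIV"
proof -
  have "vec.independent {y - x, z - x}"
    using C d by (intro independent_differences[OF k] two_capD[OF k C(1)]) auto
  hence ind: "vec.independent {w - x, y - x, z - x}"
    by (rule vec.independent_insertI[OF two_cap_notin_span[OF assms]])
  have "card {w - x, y - x, z - x} = 3" using d by auto
  hence "vec.dim (UNIV :: ('k ^ 3) set) \<le> card {w - x, y - x, z - x}"
    unfolding vec_dim_card by simp
  hence "UNIV \<subseteq> vec.span {w - x, y - x, z - x}"
    by (rule vec.card_ge_dim_independent[OF subset_UNIV ind])
  thus ?thesis by blast
qed

text \<open>Followed by translation by \<open>x\<close>, the map \<open>M\<close> takes 0 and the
  three standard basis vectors to \<open>x\<close>, \<open>y\<close>, \<open>z\<close>,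
  \<open>w\<close>. It is invertible because its columns span the space.\<close>

lemma two_cap_frame:
  fixes C :: "('k::{field,finite} ^ 3) set"
  assumes k: "CARD('k) = 3" and C: "two_cap C" "{x, y, z, w} \<subseteq> C" and d: "distinct [x, y, z, w]"
  obtains M :: "'k ^ 3 ^ 3" where "invertible M"
    "\<And>v. M *v v = v $ 1 *s (y - x) + v $ 2 *s (z - x) + v $ 3 *s (w - x)"
proof
  \<comment> \<open>\<open>vector\<close> lists the rows, hence the transpose to make the
    differences columns.\<close>
  define M where "M = transpose (vector [y - x, z - x, w - x] :: 'k ^ 3 ^ 3)"
  have col: "column 1 M = y - x" "column 2 M = z - x" "column 3 M = w - x"
    by (simp_all add: M_def column_transpose row_def vec_eq_iff)
  have "columns M = (\<lambda>i. column i M) ` UNIV" by (auto simp: columns_def)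
  also have "\<dots> = {w - x, y - x, z - x}" unfolding UNIV_3 using col by auto
  finally have "columns M = {w - x, y - x, z - x}" .
  hence "\<exists>B. M ** B = mat 1"
    unfolding matrix_right_invertible_span_columns using two_cap_span_UNIV[OF assms] by simp
  thus "invertible M" unfolding invertible_def using matrix_left_right_inverse by blast
  show "M *v v = v $ 1 *s (y - x) + v $ 2 *s (z - x) + v $ 3 *s (w - x)" for v
    by (simp add: matrix_mult_sum sum_3 col)
qed

section \<open>Caps with at least five points\<close>

lemma two_cap_fifth_point:
  fixes C :: "('k::{field,finite} ^ 3) set"
  assumes k: "CARD('k) = 3" and C: "two_cap C" "{x, y, z, w, v} \<subseteq> C" and d: "distinct [x, y, z, w, v]"
  shows "v = x + y + z + w \<or> x = v + y + z + w \<or> y = v + x + z + w \<or>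
    z = v + x + y + w \<or> w = v + x + y + z"
proof -
  have "v - x \<in> vec.span {w - x, y - x, z - x}"
    using two_cap_span_UNIV[OF k C(1), of x y z w] C(2) d by auto
  then obtain a b c where "v - x - a *s (w - x) - b *s (y - x) = c *s (z - x)"
    by (auto simp: vec.span_insert vec.span_singleton)
  moreover define A B D where ABD: "A = a *s (w - x)" "B = b *s (y - x)" "D = c *s (z - x)"
  ultimately have e: "v - x - A - B = D" by simp
  have cases: "A = 0 \<or> A = w - x \<or> A = - (w - x)" "B = 0 \<or> B = y - x \<or> B = - (y - x)"
    "D = 0 \<or> D = z - x \<or> D = - (z - x)"
    unfolding ABD by (rule smult_cases[OF k])+
  \<comment> \<open>If one of the three summands vanishes, this is applied with \<open>S\<close> the
    other two differences, and \<open>v\<close> becomes coplanar with three points of the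
    cap.\<close>
  have span: "A \<in> vec.span S \<Longrightarrow> B \<in> vec.span S \<Longrightarrow> D \<in> vec.span S \<Longrightarrow> v - x \<in> vec.span S" for S
  proof -
    have "v - x = A + B + D" using e by (simp add: algebra_simps)
    thus "A \<in> vec.span S \<Longrightarrow> B \<in> vec.span S \<Longrightarrow> D \<in> vec.span S \<Longrightarrow> v - x \<in> vec.span S"
      by (simp add: vec.span_add)
  qed
  have mem: "w - x \<in> S \<Longrightarrow> A \<in> vec.span S" "y - x \<in> S \<Longrightarrow> B \<in> vec.span S"
    "z - x \<in> S \<Longrightarrow> D \<in> vec.span S" for S
    unfolding ABD by (auto intro: vec.span_base vec.span_scale)
  have "A \<noteq> 0"
  proof
    assume "A = 0"
    hence "v - x \<in> vec.span {y - x, z - x}"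
      by (intro span) (auto intro: mem simp: vec.span_zero)
    moreover have "v - x \<notin> vec.span {y - x, z - x}"
      using C(2) d by (intro two_cap_notin_span[OF k C(1)]) auto
    ultimately show False by contradiction
  qed
  moreover have "B \<noteq> 0"
  proof
    assume "B = 0"
    hence "v - x \<in> vec.span {w - x, z - x}"
      by (intro span) (auto intro: mem simp: vec.span_zero)
    moreover have "v - x \<notin> vec.span {w - x, z - x}"
      using C(2) d by (intro two_cap_notin_span[OF k C(1)]) auto
    ultimately show False by contradiction
  qed
  moreover have "D \<noteq> 0"
  proof
    assume "D = 0"
    hence "v - x \<in> vec.span {w - x, y - x}"
      by (intro span) (auto intro: mem simp: vec.span_zero)
    moreover have "v - x \<notin> vec.span {w - x, y - x}"
      using C(2) d by (intro two_cap_notin_span[OF k C(1)]) auto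
    ultimately show False by contradiction
  qed
  ultimately have "A = w - x \<or> A = - (w - x)" "B = y - x \<or> B = - (y - x)"
      "D = z - x \<or> D = - (z - x)"
    using cases by auto
  \<comment> \<open>The eight choices of signs for \<open>A\<close>, \<open>B\<close>,
    \<open>D\<close>. Those with exactly one minus sign are the three parallelograms, which the cap
    excludes; the other five are the alternatives of the conclusion.\<close>
  with e have "v + (x + x + x) = x + y + z + w \<or> x + (x + x + x) = v + y + z + w \<or>
    y + (x + x + x) = v + x + z + w \<or> z + (x + x + x) = v + x + y + w \<or>
    w + (x + x + x) = v + x + y + z \<or> v + y = z + w \<or> v + z = y + w \<or> v + w = y + z"
    by (elim disjE; hypsubst; simp only: diff_eq_eq; simp add: algebra_simps)
  moreover have "v + y \<noteq> z + w" "v + z \<noteq> y + w" "v + w \<noteq> y + z"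
    using C(2) d by (intro two_capD(2)[OF k C(1)]; auto)+
  ultimately show ?thesis unfolding triple_eq_0[OF k] by simp
qed

text \<open>Starting from at least five points, rather than exactly five, yields the upper bound on
  the size along with the shape: a five-point subset already has this shape, and no sixth point
  fits.\<close>

lemma two_cap_ge_5:
  fixes C :: "('k::{field,finite} ^ 3) set"
  assumes k: "CARD('k) = 3" and C: "two_cap C" "card C \<ge> 5"
  obtains x y z w where "C = {x, y, z, w, x + y + z + w}" "distinct [x, y, z, w]"
proof -
  obtain T where T: "T \<subseteq> C" "card T = 5" using C(2) obtain_subset_with_card_n by metis
  obtain xs where xs: "set xs = T" "distinct xs" "length xs = 5"
    using T(2) finite_distinct_list[of T] distinct_card by fastforce
  then obtain a b c d e where "xs = [a, b, c, d, e]"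
    by (auto simp: length_Suc_conv numeral_eq_Suc)
  with xs have abcde: "T = {a, b, c, d, e}" "distinct [a, b, c, d, e]" by auto
  obtain x y z w where T': "T = {x, y, z, w, x + y + z + w}"
    and d: "distinct [x, y, z, w, x + y + z + w]"
  proof -
    note result = that
    \<comment> \<open>As \<open>T\<close> is a set, whichever point is the sum of the other four may
      be listed last, as \<open>t\<close>.\<close>
    have *: thesis if prem: "t = p + q + r + s" "T = {p, q, r, s, t}" "distinct [p, q, r, s, t]"
      for p q r s t using prem(2,3) unfolding prem(1) by (rule result)
    have "e = a + b + c + d \<or> a = e + b + c + d \<or> b = e + a + c + d \<or>
        c = e + a + b + d \<or> d = e + a + b + c"
      using T(1) abcde by (intro two_cap_fifth_point[OF k C(1)]) auto
    thus thesis
    proof (elim disjE)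
      assume "e = a + b + c + d"
      thus thesis by (rule *) (use abcde in auto)
    next
      assume "a = e + b + c + d"
      thus thesis by (rule *) (use abcde in auto)
    next
      assume "b = e + a + c + d"
      thus thesis by (rule *) (use abcde in auto)
    next
      assume "c = e + a + b + d"
      thus thesis by (rule *) (use abcde in auto)
    next
      assume "d = e + a + b + c"
      thus thesis by (rule *) (use abcde in auto)
    qed
  qed
  have "v \<in> T" if "v \<in> C" for v
  proof (rule ccontr)
    assume v: "v \<notin> T"
    let ?s = "x + y + z + w"
    \<comment> \<open>\<open>v\<close> differs from the sum \<open>?s\<close>, which rules out the
      first alternative for a fifth point. In each remaining one, adding \<open>?s\<close> and the
      frame point to \<open>v\<close> gives three equal summands, so \<open>v\<close> would be
      collinear with \<open>?s\<close> and that frame point.\<close>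
    have "x = v + y + z + w \<or> y = v + x + z + w \<or> z = v + x + y + w \<or> w = v + x + y + z"
      using two_cap_fifth_point[OF k C(1), of x y z w v] that T(1) v d unfolding T' by auto
    hence "v + ?s + x = x + x + x \<or> v + ?s + y = y + y + y \<or> v + ?s + z = z + z + z \<or>
        v + ?s + w = w + w + w"
      by (auto simp: algebra_simps)
    moreover have "v + ?s + p \<noteq> 0" if "p \<in> {x, y, z, w}" for p
      using that \<open>v \<in> C\<close> T(1) v d unfolding T' by (intro two_capD(1)[OF k C(1)]) auto
    ultimately show False unfolding triple_eq_0[OF k] by blast
  qed
  with T(1) have "C = T" by auto
  with T' d show ?thesis by (intro that) auto
qed

lemma two_cap_card_le:
  fixes C :: "('k::{field,finite} ^ 3) set"
  assumes k: "CARD('k) = 3" and C: "two_cap C"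
  shows "card C \<le> 5"
proof (rule ccontr)
  assume "\<not> card C \<le> 5"
  moreover from this obtain x y z w where "C = {x, y, z, w, x + y + z + w}"
    using two_cap_ge_5[OF k C] by (metis linorder_not_le order_less_imp_le)
  ultimately show False using card_length[of "[x, y, z, w, x + y + z + w]"] by simp
qed

section \<open>Extending caps with at most four points\<close>

text \<open>The points in \<open>v\<close> may coincide, so one condition covers lines as well as
  planes: with \<open>x = y\<close> it reads \<open>v + z \<noteq> x + x\<close>, which is
  \<open>v + z + x \<noteq> 0\<close> in characteristic 3.\<close>

lemma two_cap_insert:
  fixes C :: "('k::{field,finite} ^ 'n) set"
  assumes k: "CARD('k) = 3" and C: "two_cap C"
    and v: "\<And>x y z. x \<in> C \<Longrightarrow> y \<in> C \<Longrightarrow> z \<in> C \<Longrightarrow> v + z \<noteq> x + y"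
  shows "two_cap (insert v C)"
proof -
  have v': "v + x + y \<noteq> 0" if "x \<in> C" "y \<in> C" for x y
  proof
    assume "v + x + y = 0"
    hence "v + x + y = y + y + y" using triple_eq_0[OF k, of y] by simp
    hence "v + x = y + y" by simp
    with v that show False by blast
  qed
  have "x + y + z \<noteq> 0" if "x \<in> insert v C" "y \<in> insert v C" "z \<in> insert v C" "distinct [x, y, z]" for x y z
    using that two_capD(1)[OF k C, of x y z] v'[of x y] v'[of x z] v'[of y z] by (auto simp: ac_simps)
  moreover have "x + y \<noteq> z + w" if "x \<in> insert v C" "y \<in> insert v C" "z \<in> insert v C" "w \<in> insert v C"
    "distinct [x, y, z, w]" for x y z w
  proof -
    consider "v \<notin> {x, y, z, w}" | "v = x" | "v = y" | "v = z" | "v = w" by blast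
    thus ?thesis
    proof cases
      case 1
      thus ?thesis using that by (intro two_capD(2)[OF k C]) auto
    next
      case 2
      thus ?thesis using that v[of z w y] by auto
    next
      case 3
      thus ?thesis using that v[of z w x] by (auto simp: add.commute)
    next
      case 4
      thus ?thesis using that v[of x y w] by auto
    next
      case 5
      thus ?thesis using that v[of x y z] by (auto simp: add.commute)
    qed
  qed
  ultimately show ?thesis unfolding two_cap_iff[OF k] by blast
qed

text \<open>Any point not of the form \<open>x + y - z\<close> can be added. With at most three
  points in \<open>C\<close>, counting triples leaves such a point; with four points the 64 triples
  outnumber the 27 points, and the sum of the four points is used, computed in frame
  coordinates.\<close>

lemma two_cap_extend:
  fixes C :: "('k::{field,finite} ^ 3) set"
  assumes k: "CARD('k) = 3" and C: "two_cap C" "card C \<le> 4"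
  obtains v where "v \<notin> C" "two_cap (insert v C)"
proof -
  have "\<exists>v. \<forall>x\<in>C. \<forall>y\<in>C. \<forall>z\<in>C. v + z \<noteq> x + y"
  proof (cases "card C = 4")
    case False
    let ?f = "\<lambda>(x, y, z). x + y - z"
    have "card (?f ` (C \<times> C \<times> C)) < 27"
    proof (cases "card C \<le> 1")
      case True
      have "card (?f ` (C \<times> C \<times> C)) \<le> card (C \<times> C \<times> C)" by (rule card_image_le) simp
      also have "\<dots> \<le> 1 * (1 * 1)" unfolding card_cartesian_product using True by (intro mult_mono) auto
      finally show ?thesis by simp
    next
      case False
      then obtain x y where xy: "x \<in> C" "y \<in> C" "x \<noteq> y"
        by (metis One_nat_def card_le_Suc0_iff_eq finite)
      have "?f ` (C \<times> C \<times> C) \<subseteq> ?f ` (C \<times> C \<times> C - {(x, y, x)})"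
      proof
        fix u assume "u \<in> ?f ` (C \<times> C \<times> C)"
        then obtain t where t: "t \<in> C \<times> C \<times> C" "u = ?f t" by auto
        show "u \<in> ?f ` (C \<times> C \<times> C - {(x, y, x)})"
        proof (cases "t = (x, y, x)")
          case True
          hence "u = ?f (y, x, x)" using t by simp
          thus ?thesis using xy by (intro image_eqI[where x = "(y, x, x)"]) auto
        qed (use t in blast)
      qed
      hence "card (?f ` (C \<times> C \<times> C)) \<le> card (?f ` (C \<times> C \<times> C - {(x, y, x)}))"
        by (intro card_mono) auto
      also have "\<dots> \<le> card (C \<times> C \<times> C - {(x, y, x)})" by (rule card_image_le) simp
      also have "\<dots> < card (C \<times> C \<times> C)" using xy by (intro psubset_card_mono) auto
      also have "\<dots> \<le> 3 * (3 * 3)" unfolding card_cartesian_product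
        using C(2) \<open>card C \<noteq> 4\<close> by (intro mult_mono) auto
      finally show ?thesis by simp
    qed
    moreover have "CARD('k ^ 3) = 27" using k by simp
    ultimately have "?f ` (C \<times> C \<times> C) \<noteq> UNIV" by (metis less_irrefl)
    then obtain v where v: "v \<notin> ?f ` (C \<times> C \<times> C)" by blast
    have "v + z \<noteq> x + y" if "x \<in> C" "y \<in> C" "z \<in> C" for x y z
    proof
      assume "v + z = x + y"
      hence "v = ?f (x, y, z)" by (simp add: eq_diff_eq)
      with v that show False by blast
    qed
    thus ?thesis by blast
  next
    case True
    then obtain x y z w where xyz: "C = {x, y, z, w}" "distinct [x, y, z, w]"
      by (auto simp: card_Suc_eq numeral_eq_Suc)
    obtain M :: "'k ^ 3 ^ 3" where M: "invertible M"
      "\<And>v. M *v v = v $ 1 *s (y - x) + v $ 2 *s (z - x) + v $ 3 *s (w - x)"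
      using two_cap_frame[OF k C(1) _ xyz(2)] xyz(1) by blast
    have inj: "M *v u = M *v v \<Longrightarrow> u = v" for u v
      using M(1) by (metis invertible_def matrix_vector_mul_assoc matrix_vector_mul_lid)
    have two: "(2::'k) \<noteq> 0" "(2::'k) \<noteq> 1"
      using field_card_3(2)[OF k] eq_neg_iff_add_eq_0[of "1::'k" 1] add_left_cancel[of 1 1 "0::'k"]
      by simp_all
    define B :: "('k ^ 3) set" where "B = {0, axis 1 1, axis 2 1, axis 3 1}"
    \<comment> \<open>\<open>vector [1, 1, 1]\<close> represents the sum of the four frame points,
      since \<open>x\<close> gets the weight 1 - 3 = 1. All coordinates of the left side are 1 or 2,
      hence nonzero, whereas \<open>p + q\<close> has at most two nonzero coordinates.\<close>
    have key: "vector [1, 1, 1] + r \<noteq> p + q" if "p \<in> B" "q \<in> B" "r \<in> B" for p q r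
      using that unfolding B_def
      by (elim insertE emptyE; simp add: vec_eq_iff forall_3 axis_def two)
    have im: "C = (\<lambda>t. x + M *v t) ` B"
      by (simp add: B_def xyz(1) M(2) axis_def)
    have "x + M *v vector [1, 1, 1] + c \<noteq> a + b" if abc: "a \<in> C" "b \<in> C" "c \<in> C" for a b c
    proof
      assume h: "x + M *v vector [1, 1, 1] + c = a + b"
      obtain p q r where pqr: "p \<in> B" "q \<in> B" "r \<in> B"
        and eq: "a = x + M *v p" "b = x + M *v q" "c = x + M *v r"
        using abc unfolding im by blast
      \<comment> \<open>Each side of \<open>h\<close> contains the translation by \<open>x\<close>
        twice, so it cancels.\<close>
      have "M *v (vector [1, 1, 1] + r) = M *v (p + q)"
        using h unfolding eq by (simp add: algebra_simps)
      with key[OF pqr] inj show False by blast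
    qed
    thus ?thesis by blast
  qed
  then obtain v where v: "\<And>x y z. x \<in> C \<Longrightarrow> y \<in> C \<Longrightarrow> z \<in> C \<Longrightarrow> v + z \<noteq> x + y" by blast
  show thesis
  proof
    show "v \<notin> C" using v by blast
    show "two_cap (insert v C)" using two_cap_insert[OF k C(1) v] .
  qed
qed

section \<open>Affine equivalence of five-point caps\<close>

lemma two_cap_card_5_equivalent:
  fixes C D :: "('k::{field,finite} ^ 3) set"
  assumes k: "CARD('k) = 3" and C: "two_cap C" "card C = 5" and D: "two_cap D" "card D = 5"
  shows "affinely_equivalent C D"
proof -
  obtain x y z w where x: "C = {x, y, z, w, x + y + z + w}" "distinct [x, y, z, w]"
    using two_cap_ge_5[OF k C(1)] C(2) by (metis order_refl)
  obtain x' y' z' w' where x': "D = {x', y', z', w', x' + y' + z' + w'}" "distinct [x', y', z', w']"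
    using two_cap_ge_5[OF k D(1)] D(2) by (metis order_refl)
  obtain M :: "'k ^ 3 ^ 3" where M: "invertible M"
    "\<And>v. M *v v = v $ 1 *s (y - x) + v $ 2 *s (z - x) + v $ 3 *s (w - x)"
    using two_cap_frame[OF k C(1) _ x(2)] x(1) by blast
  obtain N :: "'k ^ 3 ^ 3" where N: "invertible N"
    "\<And>v. N *v v = v $ 1 *s (y' - x') + v $ 2 *s (z' - x') + v $ 3 *s (w' - x')"
    using two_cap_frame[OF k D(1) _ x'(2)] x'(1) by blast
  obtain B where B: "M ** B = mat 1" "B ** M = mat 1" using M(1) by (auto simp: invertible_def)
  \<comment> \<open>The linear part of the change of frame: \<open>B\<close> leads from the frame of
    \<open>C\<close> to standard coordinates, and \<open>N\<close> from there to the frame of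
    \<open>D\<close>.\<close>
  define A where "A = N ** B"
  have A: "invertible A" unfolding A_def
    using B N(1) by (intro invertible_mult) (auto simp: invertible_def)
  have AM: "A *v (M *v t) = N *v t" for t
    by (simp add: A_def matrix_vector_mul_assoc matrix_mul_assoc[symmetric] B)
  have "A *v (y - x) = y' - x'" "A *v (z - x) = z' - x'" "A *v (w - x) = w' - x'"
    using AM[of "axis 1 1"] AM[of "axis 2 1"] AM[of "axis 3 1"] by (simp_all add: M(2) N(2) axis_def)
  hence yzw: "A *v y = y' - x' + A *v x" "A *v z = z' - x' + A *v x" "A *v w = w' - x' + A *v x"
    by (simp_all add: matrix_vector_mult_diff_distrib diff_eq_eq)
  define f where "f = (\<lambda>p. A *v p + (x' - A *v x))"
  have f: "f x = x'" "f y = y'" "f z = z'" "f w = w'" by (simp_all add: f_def yzw)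
  \<comment> \<open>An affine map preserves combinations whose coefficients add up to 1, and 4 = 1
    here, so the fifth point goes to the fifth point. The triple sums added on both sides make this
    an identity over any field.\<close>
  have "f (x + y + z + w) + (x' + x' + x') = x' + y' + z' + w' + (A *v x + A *v x + A *v x)"
    by (simp add: f_def matrix_vector_right_distrib yzw algebra_simps)
  hence "f (x + y + z + w) = x' + y' + z' + w'" unfolding triple_eq_0[OF k] by simp
  hence "f ` C = D" unfolding x(1) x'(1) by (simp add: f)
  thus ?thesis using A unfolding affinely_equivalent_def f_def by blast
qed

theorem theorem3p9:
  assumes "CARD('k::{field,finite}) = 3"
  shows "(\<forall>C :: ('k ^ 3) set. maximal_two_cap C \<longrightarrow> card C = 5) \<and>
         r_two TYPE('k ^ 3) = 5 \<and>
         (\<forall>C :: ('k ^ 3) set. complete_two_cap C \<longrightarrow> maximal_two_cap C) \<and>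
         (\<forall>C D :: ('k ^ 3) set. maximal_two_cap C \<longrightarrow> maximal_two_cap D \<longrightarrow>
            affinely_equivalent C D)"
proof -
  have le: "card C \<le> 5" if "two_cap C" for C :: "('k ^ 3) set"
    using two_cap_card_le[OF assms that] .
  have comp: "card C = 5" if "complete_two_cap C" for C :: "('k ^ 3) set"
  proof (rule ccontr)
    assume "card C \<noteq> 5"
    moreover have C: "two_cap C" using that by (simp add: complete_two_cap_def)
    ultimately have "card C \<le> 4" using le[OF C] by simp
    then obtain v where "v \<notin> C" "two_cap (insert v C)" using two_cap_extend[OF assms C] by blast
    with that show False unfolding complete_two_cap_def by blast
  qed
  \<comment> \<open>A maximal cap is complete by finiteness, so its size is known from
    \<open>comp\<close>. Thus the existence of a five-point cap comes from the extension argument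
    and not from an explicit example.\<close>
  have "complete_two_cap C" if "maximal_two_cap C" for C :: "('k ^ 3) set"
    using that unfolding complete_two_cap_def maximal_two_cap_def
    by (meson finite linorder_not_le psubset_card_mono)
  hence max: "card C = 5" if "maximal_two_cap C" for C :: "('k ^ 3) set"
    using comp that by blast
  have "two_cap ({} :: ('k ^ 3) set)" by (simp add: two_cap_def)
  hence "Max (card ` {C :: ('k ^ 3) set. two_cap C}) \<in> card ` {C :: ('k ^ 3) set. two_cap C}"
    by (intro Max_in) auto
  then obtain C :: "('k ^ 3) set" where C: "two_cap C" "r_two TYPE('k ^ 3) = card C"
    unfolding r_two_def by auto
  \<comment> \<open>A cap attaining the maximum in \<open>r_two\<close> is maximal, which transfers
    the size 5 to \<open>r_two\<close>.\<close>
  have "maximal_two_cap C"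
    unfolding maximal_two_cap_def C(2)[symmetric] r_two_def using C(1) by (auto intro!: Max_ge)
  hence "r_two TYPE('k ^ 3) = 5" using max C(2) by simp
  moreover have "maximal_two_cap C" if "complete_two_cap C" for C :: "('k ^ 3) set"
    using that comp[OF that] le unfolding maximal_two_cap_def complete_two_cap_def by simp
  moreover have "affinely_equivalent C D" if "maximal_two_cap C" "maximal_two_cap D"
    for C D :: "('k ^ 3) set"
    using that max two_cap_card_5_equivalent[OF assms] unfolding maximal_two_cap_def by blast
  ultimately show ?thesis using max by blast
qed
end
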